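(* Let $A\in\mathbb{R}^{n\times n}$, $b\in\mathbb{R}^n$, let $x_0\in\mathbb{R}^n$ be an initial guess with initial residual $r_0=b-Ax_0\neq 0$, and let $\lambda\in\mathbb{R}$ be a regularization parameter. Let $k\ge 1$ with $k<n$, and suppose the Hessenberg process started from $r_0$ produces, without breakdown, the basis matrices $L_k\in\mathbb{R}^{n\times k}$ of $\mathcal{K}_k$ and $L_{k+1}\in\mathbb{R}^{n\times(k+1)}$ of $\mathcal{K}_{k+1}$. Define $$\overline{L}_{k+1}=\begin{bmatrix} L_{k+1} & 0\\ 0 & L_k\end{bmatrix}\in\mathbb{R}^{2n\times(2k+1)} .$$ Let $hr_k^G$ and $hr_k^C$ be the hybrid GMRES and hybrid CMRH residuals, respectively, at the $k$th iteration, beginning with the same initial residual $r_0$ (and with the same parameter $\lambda$). Then $$\|hr_k^G\|\;\le\;\|hr_k^C\|\;\le\;\kappa(\overline{L}_{k+1})\,\|hr_k^G\|,$$ where $\kappa(\overline{L}_{k+1})=\|\overline{L}_{k+1}\|\,\|\overline{L}_{k+1}^{\dagger}\|$ is the condition number of $\overline{L}_{k+1}$.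
   Context: $\|\cdot\|$ is the Euclidean norm for vectors and the induced spectral norm for matrices; $M^\dagger$ is the Moore–Penrose pseudoinverse of $M$. The Krylov subspaces are $\mathcal{K}_j=\mathrm{span}\{r_0,Ar_0,\dots,A^{j-1}r_0\}\subseteq\mathbb{R}^n$, where $r_0=b-Ax_0$ and $x_0$ is an arbitrary initial guess. Hessenberg process. It constructs vectors $l_1,l_2,\dots$ and an index sequence $p(1),p(2),\dots$ of distinct elements of $\{1,\dots,n\}$ as follows. Set $\beta=r_0(p(1))$ and $l_1=r_0/\beta$. For $m=1,2,\dots$: set $u=Al_m$; for $j=1,\dots,m$ in order, set $h_{j,m}=u(p(j))$ and replace $u$ by $u-h_{j,m}l_j$; finally set $h_{m+1,m}=u(p(m+1))$ and $l_{m+1}=u/h_{m+1,m}$. Without pivoting, $p(j)=j$ for all $j$; with pivoting, $p(1)$ is an index of an entry of $r_0$ of largest absolute value, and $p(m+1)$ is an index, among those not already in $\{p(1),\dots,p(m)\}$, of an entry of the final $u$ of largest absolute value. "Without breakdown" (up to $l_{k+1}$) means $\beta\ne0$ and $h_{m+1,m}\neq0$ for $m=1,\dots,k$. Put $L_j=[l_1,\dots,l_j]\in\mathbb{R}^{n\times j}$. Up to a row permutation (the identity if there is no pivoting), $L_{k+1}$ is unit lower trapezoidal, its columns are linearly independent, $\mathrm{range}(L_j)=\mathcal{K}_j$ for $j\le k+1$, and $AL_k=L_{k+1}H_{k+1,k}$, where $H_{k+1,k}\in\mathbb{R}^{(k+1)\times k}$ is the upper Hessenberg matrix with entries $h_{i,j}$.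 Hybrid residual function: for $x\in\mathbb{R}^n$, $$hr(x)=\begin{bmatrix} b\\0\end{bmatrix}-\begin{bmatrix}A\\ \lambda I\end{bmatrix}x\in\mathbb{R}^{2n}.$$ Hybrid GMRES: the $k$th iterate $x_k^G$ is a minimizer over $x\in\mathcal{K}_k$ of $\|b-Ax\|^2+\lambda^2\|x\|^2=\|hr(x)\|^2$, and $hr_k^G=hr(x_k^G)$. Hybrid CMRH (H-CMRH): the $k$th iterate $x_k^C$ is a minimizer over $x\in\mathcal{K}_k$ of $\|L_{k+1}^\dagger(b-Ax)\|^2+\lambda^2\|L_k^\dagger x\|^2$ (equivalently, of $\|\overline{L}_{k+1}^\dagger hr(x)\|^2$), and $hr_k^C=hr(x_k^C)$. *)

theory Defs
  imports Complex_Main "Jordan_Normal_Form.VS_Connect"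
begin

text \<open>Vectors and matrices are those of \<^theory>\<open>Jordan_Normal_Form.Matrix\<close>: the dimensions are
  ordinary natural numbers, and all indices (of entries, of columns and of the steps of the
  Hessenberg process) start at 0. So \<open>hess_l A r0 p m\<close> is the vector written $l_{m+1}$ with
  1-based indices.\<close>

definition vnorm :: "real vec \<Rightarrow> real" where
  "vnorm v = sqrt (v \<bullet> v)"

definition spectral_norm :: "real mat \<Rightarrow> real" where
  "spectral_norm M = Sup {vnorm (M *\<^sub>v v) | v. v \<in> carrier_vec (dim_col M) \<and> vnorm v \<le> 1}"

text \<open>The four Penrose equations.\<close>

definition is_pinv :: "real mat \<Rightarrow> real mat \<Rightarrow> bool" where
  "is_pinv M X \<longleftrightarrow>
     X \<in> carrier_mat (dim_col M) (dim_row M) \<and>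
     M * X * M = M \<and> X * M * X = X \<and>
     transpose_mat (M * X) = M * X \<and> transpose_mat (X * M) = X * M"

definition pinv :: "real mat \<Rightarrow> real mat" where
  "pinv M = (THE X. is_pinv M X)"

definition cond_number :: "real mat \<Rightarrow> real" where
  "cond_number M = spectral_norm M * spectral_norm (pinv M)"

definition krylov :: "real mat \<Rightarrow> real vec \<Rightarrow> nat \<Rightarrow> real vec set" where
  "krylov A r j =
     LinearCombinations.module.span class_ring (module_vec TYPE(real) (dim_row A))
       {(A ^\<^sub>m i) *\<^sub>v r | i. i < j}"

definition scale_at :: "nat \<Rightarrow> real vec \<Rightarrow> real vec" where
  "scale_at i u = (1 / (u $ i)) \<cdot>\<^sub>v u"

text \<open>\<open>hess_w A r0 p m\<close> is the vector that is divided by its entry \<open>p m\<close> to give the \<open>m\<close>-th basis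
  vector: \<open>r0\<close> itself for \<open>m = 0\<close>, and the final \<open>u\<close> of the elimination sweep otherwise. Hence its
  entry \<open>p m\<close> is $\beta$ for \<open>m = 0\<close>, and for \<open>m > 0\<close> the subdiagonal entry $h_{m+1,m}$ in 1-based
  indices. In the sweep the coefficient is read off the current, already updated \<open>u\<close>.\<close>

fun hess_w :: "real mat \<Rightarrow> real vec \<Rightarrow> (nat \<Rightarrow> nat) \<Rightarrow> nat \<Rightarrow> real vec" where
  "hess_w A r0 p 0 = r0"
| "hess_w A r0 p (Suc m) =
     fold (\<lambda>j u. u - (u $ p j) \<cdot>\<^sub>v scale_at (p j) (hess_w A r0 p j)) [0..<Suc m]
       (A *\<^sub>v scale_at (p m) (hess_w A r0 p m))"

definition hess_l :: "real mat \<Rightarrow> real vec \<Rightarrow> (nat \<Rightarrow> nat) \<Rightarrow> nat \<Rightarrow> real vec" where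
  "hess_l A r0 p m = scale_at (p m) (hess_w A r0 p m)"

definition hess_L :: "real mat \<Rightarrow> real vec \<Rightarrow> (nat \<Rightarrow> nat) \<Rightarrow> nat \<Rightarrow> real mat" where
  "hess_L A r0 p j = mat_of_cols (dim_row A) (map (hess_l A r0 p) [0..<j])"

text \<open>\<open>p 0, \<dots>, p k\<close> are the indices chosen by the Hessenberg process, without or with pivoting.
  Ties between entries of largest absolute value may be broken arbitrarily.\<close>

definition hess_indices ::
  "bool \<Rightarrow> real mat \<Rightarrow> real vec \<Rightarrow> (nat \<Rightarrow> nat) \<Rightarrow> nat \<Rightarrow> bool" where
  "hess_indices pivoting A r0 p k \<longleftrightarrow>
     p ` {..k} \<subseteq> {..<dim_row A} \<and> inj_on p {..k} \<and>
     (if pivoting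
      then \<forall>m\<le>k. \<forall>i\<in>{..<dim_row A} - p ` {..<m}.
             \<bar>hess_w A r0 p m $ i\<bar> \<le> \<bar>hess_w A r0 p m $ p m\<bar>
      else \<forall>m\<le>k. p m = m)"

definition hess_no_breakdown ::
  "real mat \<Rightarrow> real vec \<Rightarrow> (nat \<Rightarrow> nat) \<Rightarrow> nat \<Rightarrow> bool" where
  "hess_no_breakdown A r0 p k \<longleftrightarrow> (\<forall>m\<le>k. hess_w A r0 p m $ p m \<noteq> 0)"

text \<open>\<open>hess_Lbar A r0 p k\<close> is the block diagonal matrix written $\overline{L}_{k+1}$.\<close>

definition hess_Lbar :: "real mat \<Rightarrow> real vec \<Rightarrow> (nat \<Rightarrow> nat) \<Rightarrow> nat \<Rightarrow> real mat" where
  "hess_Lbar A r0 p k =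
     four_block_mat
       (hess_L A r0 p (k + 1))          (0\<^sub>m (dim_row A) k)
       (0\<^sub>m (dim_row A) (k + 1))        (hess_L A r0 p k)"

definition hr :: "real mat \<Rightarrow> real vec \<Rightarrow> real \<Rightarrow> real vec \<Rightarrow> real vec" where
  "hr A b lam x =
     (b @\<^sub>v 0\<^sub>v (dim_col A)) - (A @\<^sub>r (lam \<cdot>\<^sub>m 1\<^sub>m (dim_col A))) *\<^sub>v x"

definition hybrid_gmres_iterate ::
  "real mat \<Rightarrow> real vec \<Rightarrow> real \<Rightarrow> real vec \<Rightarrow> nat \<Rightarrow> real vec \<Rightarrow> bool" where
  "hybrid_gmres_iterate A b lam r0 k x \<longleftrightarrow>
     is_arg_min (\<lambda>x. (vnorm (b - A *\<^sub>v x))\<^sup>2 + lam\<^sup>2 * (vnorm x)\<^sup>2)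
       (\<lambda>x. x \<in> krylov A r0 k) x"

definition hybrid_cmrh_iterate ::
  "real mat \<Rightarrow> real vec \<Rightarrow> real \<Rightarrow> real vec \<Rightarrow> (nat \<Rightarrow> nat) \<Rightarrow> nat \<Rightarrow> real vec \<Rightarrow> bool" where
  "hybrid_cmrh_iterate A b lam r0 p k x \<longleftrightarrow>
     is_arg_min
       (\<lambda>x. (vnorm (pinv (hess_L A r0 p (k + 1)) *\<^sub>v (b - A *\<^sub>v x)))\<^sup>2
            + lam\<^sup>2 * (vnorm (pinv (hess_L A r0 p k) *\<^sub>v x))\<^sup>2)
       (\<lambda>x. x \<in> krylov A r0 k) x"

end

theory Submission
  imports Defs
begin

text \<open>Differences of hybrid residuals at points of the Krylov space lie in the range of
  \<open>hess_Lbar\<close>, but the residuals themselves need not: for \<open>x0 \<noteq> 0\<close> the vector \<open>b\<close> may leave the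
  Krylov space. So both residuals have the same component orthogonal to that range. Their
  orthogonal projections \<open>M * X * v\<close>, with \<open>M = hess_Lbar\<close> and \<open>X\<close> its pseudoinverse, differ in
  norm by a factor of at most the condition number, because \<open>vnorm (X * v)\<close> is the objective minimized
  by CMRH. As the condition number is at least 1, Pythagoras combines the two parts.\<close>

section \<open>Euclidean and spectral norm\<close>

lemma scalar_prod_self_nonneg: "0 \<le> (v :: real vec) \<bullet> v"
  unfolding scalar_prod_def by (intro sum_nonneg) simp

lemma vnorm_nonneg [simp]: "0 \<le> vnorm v"
  by (simp add: vnorm_def scalar_prod_self_nonneg)

lemma vnorm_power2: "(vnorm v)\<^sup>2 = v \<bullet> v"
  by (simp add: vnorm_def scalar_prod_self_nonneg)

lemma vnorm_power2_sum: "(vnorm v)\<^sup>2 = (\<Sum>i<dim_vec v. (v $ i)\<^sup>2)"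
  unfolding vnorm_power2 by (simp add: scalar_prod_def power2_eq_square atLeast0LessThan)

lemma vnorm_zero [simp]: "vnorm (0\<^sub>v n) = 0"
  by (simp add: vnorm_def)

lemma vnorm_smult: "vnorm (c \<cdot>\<^sub>v v) = \<bar>c\<bar> * vnorm v"
proof (rule power2_eq_imp_eq)
  show "(vnorm (c \<cdot>\<^sub>v v))\<^sup>2 = (\<bar>c\<bar> * vnorm v)\<^sup>2"
    by (simp add: vnorm_power2_sum power_mult_distrib sum_distrib_left)
qed simp_all

lemma vnorm_append_power2: "(vnorm (v @\<^sub>v w))\<^sup>2 = (vnorm v)\<^sup>2 + (vnorm w)\<^sup>2"
  unfolding vnorm_power2 by (rule scalar_prod_append[of _ "dim_vec v" _ "dim_vec w"]) auto

lemma abs_entry_le_vnorm: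
  assumes "i < dim_vec v"
  shows "\<bar>v $ i\<bar> \<le> vnorm v"
proof (rule power2_le_imp_le)
  have "(v $ i)\<^sup>2 \<le> (\<Sum>j<dim_vec v. (v $ j)\<^sup>2)"
    using assms by (intro member_le_sum) auto
  then show "\<bar>v $ i\<bar>\<^sup>2 \<le> (vnorm v)\<^sup>2"
    by (simp add: vnorm_power2_sum)
qed simp

lemma vnorm_eq_0_iff:
  assumes "v \<in> carrier_vec n"
  shows "vnorm v = 0 \<longleftrightarrow> v = 0\<^sub>v n"
proof
  assume "vnorm v = 0"
  then show "v = 0\<^sub>v n"
    using assms abs_entry_le_vnorm[of _ v] by (intro eq_vecI) auto
qed simp

text \<open>Needed because \<open>Sup\<close> on the reals is an upper bound only for sets bounded
  above. The entries of a vector of norm at most 1 are at most 1 in absolute value, so each entry of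
  \<open>M *\<^sub>v v\<close> is bounded by the absolute row sum.\<close>

lemma spectral_norm_bdd_above:
  "bdd_above {vnorm (M *\<^sub>v v) | v. v \<in> carrier_vec (dim_col M) \<and> vnorm v \<le> 1}"
proof (rule bdd_aboveI)
  fix y assume "y \<in> {vnorm (M *\<^sub>v v) | v. v \<in> carrier_vec (dim_col M) \<and> vnorm v \<le> 1}"
  then obtain v where y: "y = vnorm (M *\<^sub>v v)"
    and v: "v \<in> carrier_vec (dim_col M)" and v1: "vnorm v \<le> 1" by blast
  have "\<bar>(M *\<^sub>v v) $ i\<bar> \<le> (\<Sum>j<dim_col M. \<bar>M $$ (i, j)\<bar>)" if i: "i < dim_row M" for i
  proof -
    have "(M *\<^sub>v v) $ i = (\<Sum>j<dim_col M. M $$ (i, j) * v $ j)"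
      using i v by (auto simp: scalar_prod_def atLeast0LessThan)
    also have "\<bar>\<dots>\<bar> \<le> (\<Sum>j<dim_col M. \<bar>M $$ (i, j) * v $ j\<bar>)"
      by (rule sum_abs)
    also have "\<dots> \<le> (\<Sum>j<dim_col M. \<bar>M $$ (i, j)\<bar>)"
    proof (rule sum_mono)
      fix j assume "j \<in> {..<dim_col M}"
      then have "\<bar>v $ j\<bar> \<le> 1"
        using v v1 abs_entry_le_vnorm[of j v] by auto
      then show "\<bar>M $$ (i, j) * v $ j\<bar> \<le> \<bar>M $$ (i, j)\<bar>"
        by (simp add: abs_mult mult_left_le)
    qed
    finally show ?thesis .
  qed
  then have "y\<^sup>2 \<le> (\<Sum>i<dim_row M. (\<Sum>j<dim_col M. \<bar>M $$ (i, j)\<bar>)\<^sup>2)"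
    unfolding y vnorm_power2_sum by (auto intro!: sum_mono abs_le_square_iff[THEN iffD1] simp: sum_nonneg)
  then show "y \<le> sqrt (\<Sum>i<dim_row M. (\<Sum>j<dim_col M. \<bar>M $$ (i, j)\<bar>)\<^sup>2)"
    by (rule real_le_rsqrt)
qed

text \<open>The supremum ranges over the unit ball only; a general nonzero vector is reduced to it
  by normalisation.\<close>

lemma vnorm_mult_mat_vec_le:
  assumes v: "v \<in> carrier_vec (dim_col M)"
  shows "vnorm (M *\<^sub>v v) \<le> spectral_norm M * vnorm v"
proof (cases "vnorm v = 0")
  case True
  then have "M *\<^sub>v v = 0\<^sub>v (dim_row M)"
    using v by (auto simp: vnorm_eq_0_iff)
  with True show ?thesis by simp
next
  case False
  then have pos: "vnorm v > 0"
    using vnorm_nonneg[of v] by linarith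
  define u where "u = (1 / vnorm v) \<cdot>\<^sub>v v"
  have u: "u \<in> carrier_vec (dim_col M)" and "vnorm u \<le> 1"
    using v pos by (simp_all add: u_def vnorm_smult)
  then have "vnorm (M *\<^sub>v u) \<le> spectral_norm M"
    unfolding spectral_norm_def by (intro cSup_upper spectral_norm_bdd_above) blast
  moreover have "vnorm (M *\<^sub>v u) = vnorm (M *\<^sub>v v) / vnorm v"
    using v pos mult_mat_vec[of M "dim_row M" "dim_col M" v] by (simp add: u_def vnorm_smult)
  ultimately show ?thesis
    using pos by (simp add: field_simps)
qed

lemma spectral_norm_nonneg: "0 \<le> spectral_norm M"
proof -
  have "vnorm (M *\<^sub>v 0\<^sub>v (dim_col M)) \<le> spectral_norm M"
    unfolding spectral_norm_def by (rule cSup_upper[OF _ spectral_norm_bdd_above]) force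
  then show ?thesis
    using vnorm_nonneg order_trans by blast
qed

section \<open>Moore-Penrose pseudoinverse\<close>

text \<open>The Penrose equations are bracketed to the left; automatic reassociation to the right
  would hide their left-hand sides.\<close>

declare assoc_mult_mat [simp del]

lemma is_pinvD:
  assumes "is_pinv M X" and "M \<in> carrier_mat m q"
  shows "X \<in> carrier_mat q m" "M * X * M = M" "X * M * X = X"
    "transpose_mat (M * X) = M * X" "transpose_mat (X * M) = X * M"
  using assms unfolding is_pinv_def by auto

text \<open>\<open>M * X\<close> and \<open>M * Y\<close> are symmetric idempotents with the same
  range, so each absorbs the other and transposition identifies them; likewise for
  \<open>X * M\<close> and \<open>Y * M\<close>. Then
  \<open>X = X * M * X = X * M * Y = Y * M * Y = Y\<close>.\<close>

lemma is_pinv_unique: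
  assumes X: "is_pinv M X" and Y: "is_pinv M Y"
  shows "X = Y"
proof -
  define m q where "m = dim_row M" and "q = dim_col M"
  have M: "M \<in> carrier_mat m q" by (simp add: m_def q_def)
  note X = is_pinvD[OF X M] and Y = is_pinvD[OF Y M]
  have MX': "M * X \<in> carrier_mat m m" and MY': "M * Y \<in> carrier_mat m m"
    and XM': "X * M \<in> carrier_mat q q" and YM': "Y * M \<in> carrier_mat q q"
    using M X(1) Y(1) by auto
  have "M * X = (M * Y) * (M * X)"
    using assoc_mult_mat[OF MY' M X(1)] Y(2) by simp
  also have "\<dots> = transpose_mat ((M * X) * (M * Y))"
    using transpose_mult[OF MX' MY'] X(4) Y(4) by simp
  also have "(M * X) * (M * Y) = M * Y"
    using assoc_mult_mat[OF MX' M Y(1)] X(2) by simp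
  finally have MX: "M * X = M * Y" using Y(4) by simp
  have "X * M = (X * M) * (Y * M)"
    using assoc_mult_mat[OF XM' Y(1) M] assoc_mult_mat[OF X(1) M Y(1)]
      assoc_mult_mat[OF X(1) MY' M] Y(2) by simp
  also have "\<dots> = transpose_mat ((Y * M) * (X * M))"
    using transpose_mult[OF YM' XM'] X(5) Y(5) by simp
  also have "(Y * M) * (X * M) = Y * M"
    using assoc_mult_mat[OF YM' X(1) M] assoc_mult_mat[OF Y(1) M X(1)]
      assoc_mult_mat[OF Y(1) MX' M] X(2) by simp
  finally have XM: "X * M = Y * M" using Y(5) by simp
  have "X = X * M * Y"
    using assoc_mult_mat[OF X(1) M X(1)] assoc_mult_mat[OF X(1) M Y(1)] X(3) MX by simp
  also have "\<dots> = Y" using XM Y(3) by simp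
  finally show ?thesis .
qed

lemma pinv_eqI: "is_pinv M X \<Longrightarrow> pinv M = X"
  unfolding pinv_def by (rule the_equality) (auto intro: is_pinv_unique)

text \<open>For full column rank the pseudoinverse is explicit: the inverse of the Gram matrix
  \<open>G\<close> times the transpose of \<open>M\<close>. Uniqueness identifies it with
  \<open>pinv M\<close>.\<close>

lemma is_pinv_pinv:
  assumes M: "M \<in> carrier_mat m q"
    and inj: "\<And>v. v \<in> carrier_vec q \<Longrightarrow> M *\<^sub>v v = 0\<^sub>v m \<Longrightarrow> v = 0\<^sub>v q"
  shows "is_pinv M (pinv M)"
proof -
  define G where "G = transpose_mat M * M"
  have G: "G \<in> carrier_mat q q" using M by (simp add: G_def)
  have "v = 0\<^sub>v q" if v: "v \<in> carrier_vec q" and Gv: "G *\<^sub>v v = 0\<^sub>v q" for v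
  proof -
    have Mv: "M *\<^sub>v v \<in> carrier_vec m" using M v by auto
    have "transpose_mat M *\<^sub>v (M *\<^sub>v v) = 0\<^sub>v q"
      using Gv M v assoc_mult_mat_vec[of "transpose_mat M" q m M q v] by (simp add: G_def)
    \<comment> \<open>The quadratic form of \<open>G\<close> at \<open>v\<close> is the squared norm
      of \<open>M *\<^sub>v v\<close>, so \<open>G\<close> inherits the trivial kernel of
      \<open>M\<close>.\<close>
    then have "(M *\<^sub>v v) \<bullet> (M *\<^sub>v v) = 0"
      using transpose_vec_mult_scalar[OF M v Mv] v by simp
    then have "vnorm (M *\<^sub>v v) = 0" by (simp add: vnorm_def)
    then show ?thesis using inj[OF v] vnorm_eq_0_iff[OF Mv] by simp
  qed
  then have "det G \<noteq> 0" using det_0_iff_vec_prod_zero_field[OF G] by blast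
  then obtain H where H: "H \<in> carrier_mat q q" and HG: "H * G = 1\<^sub>m q" and GH: "G * H = 1\<^sub>m q"
    using det_non_zero_imp_unit[OF G, of "TYPE(unit)"]
    unfolding Units_def by (auto simp: ring_mat_simps)
  have "transpose_mat G = G"
    unfolding G_def using M by (subst transpose_mult[of _ q m _ q]) auto
  \<comment> \<open>Since \<open>G\<close> is symmetric, the transpose of its right inverse
    \<open>H\<close> is a left inverse, and the two must coincide.\<close>
  then have "transpose_mat H * G = 1\<^sub>m q"
    using transpose_mult[OF G H] GH by simp
  then have "transpose_mat H * G * H = H" using H by simp
  then have HT: "transpose_mat H = H"
    using assoc_mult_mat[of "transpose_mat H" q q G q H q] G H GH by simp
  define X where "X = H * transpose_mat M"
  have X: "X \<in> carrier_mat q m" using H M by (simp add: X_def)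
  have XM: "X * M = 1\<^sub>m q"
    using HG assoc_mult_mat[of H q q "transpose_mat M" m M q] H M by (simp add: X_def G_def)
  have MXM: "M * X * M = M"
    using assoc_mult_mat[OF M X M] XM M by simp
  have "transpose_mat X = M * H"
    unfolding X_def using H M HT by (subst transpose_mult[of _ q q _ m]) auto
  then have "transpose_mat (M * X) = M * H * transpose_mat M"
    using transpose_mult[OF M X] by simp
  also have "\<dots> = M * X"
    unfolding X_def using M H by (intro assoc_mult_mat) auto
  finally have "is_pinv M X"
    unfolding is_pinv_def using M X XM MXM by auto
  then show ?thesis using pinv_eqI[of M X] by simp
qed

text \<open>Products and transposes of block diagonal matrices are taken blockwise, so each Penrose
  equation splits into one equation for each block.\<close>

lemma is_pinv_block_diag:
  assumes M: "M \<in> carrier_mat m q" and N: "N \<in> carrier_mat m' q'"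
    and X: "is_pinv M X" and Y: "is_pinv N Y"
  shows "is_pinv (four_block_mat M (0\<^sub>m m q') (0\<^sub>m m' q) N)
           (four_block_mat X (0\<^sub>m q m') (0\<^sub>m q' m) Y)"
proof -
  let ?M = "four_block_mat M (0\<^sub>m m q') (0\<^sub>m m' q) N"
  let ?X = "four_block_mat X (0\<^sub>m q m') (0\<^sub>m q' m) Y"
  note X = is_pinvD[OF X M] and Y = is_pinvD[OF Y N]
  have MX: "?M * ?X = four_block_mat (M * X) (0\<^sub>m m m') (0\<^sub>m m' m) (N * Y)"
    using M N X(1) Y(1) by (subst mult_four_block_mat[of _ m q _ q' _ m' _ _ m _ m']) auto
  have XM: "?X * ?M = four_block_mat (X * M) (0\<^sub>m q q') (0\<^sub>m q' q) (Y * N)"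
    using M N X(1) Y(1) by (subst mult_four_block_mat[of _ q m _ m' _ q' _ _ q _ q']) auto
  have "?M * ?X * ?M = ?M"
    unfolding MX using M N X Y
    by (subst mult_four_block_mat[of _ m m _ m' _ m' _ _ q _ q']) auto
  moreover have "?X * ?M * ?X = ?X"
    unfolding XM using M N X Y
    by (subst mult_four_block_mat[of _ q q _ q' _ q' _ _ m _ m']) auto
  moreover have "transpose_mat (?M * ?X) = ?M * ?X"
    unfolding MX using M N X Y by (subst transpose_four_block_mat[of _ m m _ m' _ m']) auto
  moreover have "transpose_mat (?X * ?M) = ?X * ?M"
    unfolding XM using M N X Y by (subst transpose_four_block_mat[of _ q q _ q' _ q']) auto
  ultimately show ?thesis
    unfolding is_pinv_def using M N X(1) Y(1) by auto
qed

section \<open>Orthogonal projection onto the range and the condition number\<close>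

lemma is_pinv_pythagoras:
  assumes M: "M \<in> carrier_mat m q" and X: "is_pinv M X" and v: "v \<in> carrier_vec m"
  shows "(vnorm v)\<^sup>2 = (vnorm (M *\<^sub>v (X *\<^sub>v v)))\<^sup>2 + (vnorm (v - M *\<^sub>v (X *\<^sub>v v)))\<^sup>2"
proof -
  note X = is_pinvD[OF X M]
  define w where "w = M *\<^sub>v (X *\<^sub>v v)"
  have w: "w \<in> carrier_vec m" using M X(1) v by (simp add: w_def)
  have MX: "M * X \<in> carrier_mat m m" using M X(1) by simp
  have wMX: "w = (M * X) *\<^sub>v v" using M X(1) v by (simp add: w_def)
  have "(M * X) *\<^sub>v w = (M * X * (M * X)) *\<^sub>v v"
    unfolding wMX using MX v by simp
  also have "M * X * (M * X) = M * X"
    using assoc_mult_mat[OF MX M X(1)] X(2) by simp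
  finally have "(M * X) *\<^sub>v w = w" by (simp add: wMX)
  \<comment> \<open>The symmetry of \<open>M * X\<close> moves it to the other factor, where it
    fixes \<open>w\<close>; hence \<open>w\<close> is orthogonal to \<open>v - w\<close>.\<close>
  then have "w \<bullet> v = w \<bullet> w"
    using transpose_vec_mult_scalar[OF MX v w] X(4) wMX by simp
  moreover have "v \<bullet> w = w \<bullet> v" using v w by (rule comm_scalar_prod)
  ultimately show ?thesis
    unfolding vnorm_power2 w_def[symmetric] using v w
    by (simp add: minus_scalar_prod_distrib[of _ m] scalar_prod_minus_distrib[of _ m])
qed

text \<open>A nonzero vector \<open>y\<close> in the range is fixed by \<open>M * X\<close>, so its
  norm is at most the product of the two spectral norms times itself.\<close>

lemma cond_number_ge_1:
  assumes M: "M \<in> carrier_mat m q" and X: "is_pinv M X"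
    and v: "v \<in> carrier_vec q" and nz: "M *\<^sub>v v \<noteq> 0\<^sub>v m"
  shows "1 \<le> cond_number M"
proof -
  note X' = is_pinvD[OF X M]
  define y where "y = M *\<^sub>v v"
  have y: "y \<in> carrier_vec m" using M v by (simp add: y_def)
  have pos: "0 < vnorm y"
    using nz vnorm_eq_0_iff[OF y] vnorm_nonneg[of y] by (auto simp: y_def less_le)
  have "M *\<^sub>v (X *\<^sub>v y) = (M * X * M) *\<^sub>v v"
    using assoc_mult_mat_vec[OF mult_carrier_mat[OF M X'(1)] M v]
      assoc_mult_mat_vec[OF M X'(1)] M v by (simp add: y_def)
  then have "M *\<^sub>v (X *\<^sub>v y) = y" using X'(2) by (simp add: y_def)
  moreover have "vnorm (M *\<^sub>v (X *\<^sub>v y)) \<le> spectral_norm M * vnorm (X *\<^sub>v y)"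
    using M X'(1) y by (intro vnorm_mult_mat_vec_le) auto
  moreover have "spectral_norm M * vnorm (X *\<^sub>v y) \<le> spectral_norm M * (spectral_norm X * vnorm y)"
    using X'(1) y by (intro mult_left_mono vnorm_mult_mat_vec_le spectral_norm_nonneg) auto
  ultimately have "1 * vnorm y \<le> cond_number M * vnorm y"
    unfolding cond_number_def pinv_eqI[OF X] by (simp add: mult.assoc)
  with pos show ?thesis by (simp only: mult_le_cancel_right_pos)
qed

lemma vnorm_le_cond_number_mult:
  assumes M: "M \<in> carrier_mat m q" and X: "is_pinv M X"
    and c: "c \<in> carrier_vec m" and g: "g \<in> carrier_vec m"
    and y: "y \<in> carrier_vec q" and cg: "c = g + M *\<^sub>v y"
    and le: "vnorm (X *\<^sub>v c) \<le> vnorm (X *\<^sub>v g)"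
    and cond: "1 \<le> cond_number M"
  shows "vnorm c \<le> cond_number M * vnorm g"
proof (rule power2_le_imp_le)
  note X' = is_pinvD[OF X M]
  define P where "P v = M *\<^sub>v (X *\<^sub>v v)" for v
  have P: "P v \<in> carrier_vec m" if "v \<in> carrier_vec m" for v
    using that M X'(1) by (simp add: P_def)
  have "P (M *\<^sub>v y) = (M * X * M) *\<^sub>v y"
    using assoc_mult_mat_vec[OF mult_carrier_mat[OF M X'(1)] M y]
      assoc_mult_mat_vec[OF M X'(1)] M y by (simp add: P_def)
  \<comment> \<open>\<open>P\<close> fixes the range of \<open>M\<close>, so adding
    \<open>M *\<^sub>v y\<close> changes the projection but not the orthogonal remainder.\<close>
  then have "P c = P g + M *\<^sub>v y"
    unfolding cg P_def using M X'(1,2) y g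
    by (simp add: mult_add_distrib_mat_vec[of _ q m] mult_add_distrib_mat_vec[of _ m q])
  then have orth: "c - P c = g - P g"
    unfolding cg using g M y P[OF g] by (intro eq_vecI) auto
  have "vnorm (P c) \<le> spectral_norm M * vnorm (X *\<^sub>v c)"
    unfolding P_def using M X'(1) c by (intro vnorm_mult_mat_vec_le) auto
  also have "\<dots> \<le> spectral_norm M * vnorm (X *\<^sub>v g)"
    using le by (intro mult_left_mono spectral_norm_nonneg)
  \<comment> \<open>\<open>X\<close> sees only the projection of its argument. This puts
    \<open>P g\<close> in the bound instead of \<open>g\<close>, leaving the orthogonal remainder to
    be added separately.\<close>
  also have "X *\<^sub>v g = (X * M * X) *\<^sub>v g" using X'(3) by simp
  also have "\<dots> = X *\<^sub>v P g"
    using assoc_mult_mat_vec[OF mult_carrier_mat[OF X'(1) M] X'(1) g]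
      assoc_mult_mat_vec[OF X'(1) M] X'(1) g by (simp add: P_def)
  also have "spectral_norm M * vnorm (X *\<^sub>v P g) \<le> spectral_norm M * (spectral_norm X * vnorm (P g))"
    using X'(1) P[OF g] by (intro mult_left_mono vnorm_mult_mat_vec_le spectral_norm_nonneg) auto
  finally have "vnorm (P c) \<le> cond_number M * vnorm (P g)"
    unfolding cond_number_def pinv_eqI[OF X] by (simp add: mult.assoc)
  then have "(vnorm (P c))\<^sup>2 \<le> (cond_number M)\<^sup>2 * (vnorm (P g))\<^sup>2"
    using power_mono[of "vnorm (P c)" "cond_number M * vnorm (P g)" 2] by (simp add: power_mult_distrib)
  \<comment> \<open>The common remainder would carry factor 1; enlarging it to the squared condition
    number lets Pythagoras recombine both parts under one factor.\<close>
  moreover have "1 * (vnorm (g - P g))\<^sup>2 \<le> (cond_number M)\<^sup>2 * (vnorm (g - P g))\<^sup>2"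
    using cond by (intro mult_right_mono one_le_power) auto
  ultimately have "(vnorm c)\<^sup>2 \<le> (cond_number M)\<^sup>2 * (vnorm g)\<^sup>2"
    using is_pinv_pythagoras[OF M X c] is_pinv_pythagoras[OF M X g] orth
    by (simp add: P_def distrib_left)
  then show "(vnorm c)\<^sup>2 \<le> (cond_number M * vnorm g)\<^sup>2"
    by (simp add: power_mult_distrib)
  show "0 \<le> cond_number M * vnorm g" using cond by simp
qed

section \<open>The Hessenberg process\<close>

text \<open>The recursion equation stated through the basis vectors, so that later proofs treat
  these as fixed vectors instead of unfolding them.\<close>

lemma hess_w_Suc:
  "hess_w A r p (Suc m) =
     fold (\<lambda>j u. u - (u $ p j) \<cdot>\<^sub>v hess_l A r p j) [0..<Suc m] (A *\<^sub>v hess_l A r p m)"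
  by (simp add: hess_l_def)

declare hess_w.simps(2) [simp del]

text \<open>The coefficient \<open>f u j\<close> may depend on the current vector, as in the
  Hessenberg sweep, where it is an entry of the updated \<open>u\<close>.\<close>

lemma fold_minus_smult_carrier:
  assumes "u \<in> carrier_vec n" and "\<And>j. j \<in> set js \<Longrightarrow> l j \<in> carrier_vec n"
  shows "fold (\<lambda>j u. u - f u j \<cdot>\<^sub>v l j) js u \<in> carrier_vec n"
  using assms by (induction js arbitrary: u) auto

lemma hess_carrier:
  assumes A: "A \<in> carrier_mat n n" and r: "r \<in> carrier_vec n"
  shows "hess_w A r p m \<in> carrier_vec n" and "hess_l A r p m \<in> carrier_vec n"
proof -
  show w: "hess_w A r p m \<in> carrier_vec n"
  proof (induction m rule: less_induct)
    case (less m)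
    show ?case
    proof (cases m)
      case 0
      then show ?thesis using r by simp
    next
      case (Suc m')
      then show ?thesis
        unfolding Suc hess_w_Suc using A less.IH
        by (intro fold_minus_smult_carrier)
          (auto simp: Suc hess_l_def scale_at_def intro!: mult_mat_vec_carrier[OF A])
    qed
  qed
  then show "hess_l A r p m \<in> carrier_vec n"
    by (simp add: hess_l_def scale_at_def)
qed

lemma hess_L_carrier [simp]: "hess_L A r p j \<in> carrier_mat (dim_row A) j"
  unfolding hess_L_def using mat_of_cols_carrier(1)[of "dim_row A" "map (hess_l A r p) [0..<j]"]
  by (simp del: mat_of_cols_carrier)

lemma hess_L_mult_vec_index:
  assumes "A \<in> carrier_mat n n" "r \<in> carrier_vec n" "c \<in> carrier_vec j" "i < n"
  shows "(hess_L A r p j *\<^sub>v c) $ i = (\<Sum>q<j. hess_l A r p q $ i * c $ q)"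
  using assms hess_carrier(2)[OF assms(1,2)]
  by (auto simp: hess_L_def scalar_prod_def atLeast0LessThan mat_of_cols_index intro!: sum.cong)

lemma hess_L_Suc_mult_vec:
  assumes A: "A \<in> carrier_mat n n" and r: "r \<in> carrier_vec n" and c: "c \<in> carrier_vec (Suc j)"
  shows "hess_L A r p (Suc j) *\<^sub>v c
    = hess_L A r p j *\<^sub>v vec_first c j + (c $ j) \<cdot>\<^sub>v hess_l A r p j"
proof (rule eq_vecI)
  fix i assume "i < dim_vec (hess_L A r p j *\<^sub>v vec_first c j + (c $ j) \<cdot>\<^sub>v hess_l A r p j)"
  then have i: "i < n" using hess_carrier(2)[OF A r, of p j] by simp
  have "(hess_L A r p j *\<^sub>v vec_first c j + (c $ j) \<cdot>\<^sub>v hess_l A r p j) $ i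
      = (\<Sum>q<j. hess_l A r p q $ i * vec_first c j $ q) + c $ j * hess_l A r p j $ i"
    using i A hess_carrier(2)[OF A r, of p j]
      hess_L_carrier[of A r p j]
    by (simp add: hess_L_mult_vec_index[OF A r _ i] del: index_mult_mat_vec)
  then show "(hess_L A r p (Suc j) *\<^sub>v c) $ i
      = (hess_L A r p j *\<^sub>v vec_first c j + (c $ j) \<cdot>\<^sub>v hess_l A r p j) $ i"
    by (simp add: hess_L_mult_vec_index[OF A r c i] vec_first_def)
qed (use A hess_carrier(2)[OF A r, of p j] in \<open>auto simp: hess_L_def\<close>)

section \<open>Trapezoidal shape and linear independence of the Hessenberg basis\<close>

lemma hess_l_pivot:
  assumes A: "A \<in> carrier_mat n n" and r: "r \<in> carrier_vec n"
    and "hess_no_breakdown A r p k" and "m \<le> k" and "p m < n"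
  shows "hess_l A r p m $ p m = 1"
  using assms hess_carrier(1)[OF A r, of p m]
  by (simp add: hess_l_def scale_at_def hess_no_breakdown_def)

text \<open>Together with the unit pivots this is the lower trapezoidal shape in the row order
  \<open>p 0\<close>, \<open>p 1\<close>, and so on. The outer induction gives the zeros of earlier
  basis vectors; the inner one follows a single sweep.\<close>

lemma hess_l_eliminated:
  assumes A: "A \<in> carrier_mat n n" and r: "r \<in> carrier_vec n"
    and nb: "hess_no_breakdown A r p k" and p: "p ` {..k} \<subseteq> {..<n}"
    and "m \<le> k" and "i < m"
  shows "hess_l A r p m $ p i = 0"
  using assms(5,6)
proof (induction m arbitrary: i rule: less_induct)
  case (less m)
  then obtain m' where m: "m = Suc m'" by (cases m) auto
  let ?f = "\<lambda>j u. u - (u $ p j) \<cdot>\<^sub>v hess_l A r p j"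
  have pn: "p j < n" if "j \<le> k" for j using p that by auto
  \<comment> \<open>Invariant: after \<open>s\<close> steps the first \<open>s\<close> pivot entries
    vanish. Step \<open>s\<close> clears entry \<open>p s\<close> because the subtracted vector has
    entry 1 there, and it keeps the earlier zeros because that vector vanishes at earlier
    pivots.\<close>
  have "fold ?f [0..<s] (A *\<^sub>v hess_l A r p m') \<in> carrier_vec n \<and>
        (\<forall>i<s. fold ?f [0..<s] (A *\<^sub>v hess_l A r p m') $ p i = 0)" if "s \<le> m" for s
    using that
  proof (induction s)
    case 0
    then show ?case using A hess_carrier(2)[OF A r, of p m'] by simp
  next
    case (Suc s)
    let ?u = "fold ?f [0..<s] (A *\<^sub>v hess_l A r p m')"
    have u: "?u \<in> carrier_vec n" and u0: "\<forall>i<s. ?u $ p i = 0" using Suc by auto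
    have l: "hess_l A r p s \<in> carrier_vec n" by (rule hess_carrier(2)[OF A r])
    have "(?f s ?u) $ p i = 0" if i: "i < Suc s" for i
    proof -
      have ix: "(?f s ?u) $ p i = ?u $ p i - ?u $ p s * hess_l A r p s $ p i"
        using pn[of i] u l i Suc.prems less.prems by simp
      show ?thesis
      proof (cases "i = s")
        case True
        then show ?thesis
          using ix hess_l_pivot[OF A r nb, of s] pn[of s] Suc.prems less.prems by simp
      next
        case False
        then show ?thesis
          using ix u0 less.IH[of s i] i Suc.prems less.prems by simp
      qed
    qed
    then show ?case using u l by simp
  qed
  from this[of m] have w: "hess_w A r p m \<in> carrier_vec n" "hess_w A r p m $ p i = 0"
    using less.prems unfolding m hess_w_Suc by auto
  then show ?case
    using pn[of i] less.prems by (simp add: hess_l_def scale_at_def)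
qed

text \<open>Forward substitution along the pivot rows: in row \<open>p i\<close> the terms with
  \<open>q < i\<close> vanish by induction and those with \<open>q > i\<close> by elimination, which
  leaves \<open>c $ i\<close>.\<close>

lemma hess_L_mult_vec_eq_0:
  assumes A: "A \<in> carrier_mat n n" and r: "r \<in> carrier_vec n"
    and nb: "hess_no_breakdown A r p k" and p: "p ` {..k} \<subseteq> {..<n}"
    and j: "j \<le> Suc k" and c: "c \<in> carrier_vec j" and 0: "hess_L A r p j *\<^sub>v c = 0\<^sub>v n"
  shows "c = 0\<^sub>v j"
proof -
  have "c $ i = 0" if "i < j" for i
    using that
  proof (induction i rule: less_induct)
    case (less i)
    have "i \<le> k" using less.prems j by simp
    then have pi: "p i < n" using p by auto
    have "hess_l A r p q $ p i * c $ q = (if q = i then c $ i else 0)" if "q < j" for q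
    proof -
      consider "q < i" | "q = i" | "i < q" by linarith
      then show ?thesis
        using less hess_l_pivot[OF A r nb _ pi] hess_l_eliminated[OF A r nb p, of q i] that j
        by cases auto
    qed
    then have "(hess_L A r p j *\<^sub>v c) $ p i = c $ i"
      using less.prems by (simp add: hess_L_mult_vec_index[OF A r c pi])
    then show ?case using 0 pi by simp
  qed
  then show ?thesis using c by (intro eq_vecI) auto
qed

lemma is_pinv_hess_L:
  assumes "A \<in> carrier_mat n n" and "r \<in> carrier_vec n"
    and "hess_no_breakdown A r p k" and "p ` {..k} \<subseteq> {..<n}" and "j \<le> Suc k"
  shows "is_pinv (hess_L A r p j) (pinv (hess_L A r p j))"
  using hess_L_mult_vec_eq_0[OF assms] assms(1) hess_L_carrier[of A r p j]
  by (intro is_pinv_pinv[of _ n j]) auto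

section \<open>Krylov subspaces\<close>

text \<open>Describing the range by coefficient vectors lets a membership proof yield the
  coefficients directly.\<close>

definition mat_range :: "real mat \<Rightarrow> real vec set" where
  "mat_range M = (\<lambda>c. M *\<^sub>v c) ` carrier_vec (dim_col M)"

lemma mat_range_submodule:
  assumes M: "M \<in> carrier_mat n q"
  shows "submodule class_ring (mat_range M) (module_vec TYPE(real) n)"
proof -
  interpret vec_space "TYPE(real)" n .
  have add: "M *\<^sub>v c + M *\<^sub>v d \<in> mat_range M" if "c \<in> carrier_vec q" "d \<in> carrier_vec q" for c d
    using that M mult_add_distrib_mat_vec[OF M that, symmetric] by (auto simp: mat_range_def)
  have smult: "a \<cdot>\<^sub>v (M *\<^sub>v c) \<in> mat_range M" if "c \<in> carrier_vec q" for a c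
    using that M mult_mat_vec[OF M that, of a, symmetric] by (auto simp: mat_range_def)
  have zero: "0\<^sub>v n \<in> mat_range M"
    unfolding mat_range_def using M by (intro image_eqI[of _ _ "0\<^sub>v q"]) auto
  show ?thesis
    using M add smult zero
    by unfold_locales (auto simp: module_vec_simps mat_range_def)
qed

lemma mat_range_carrier: "M \<in> carrier_mat n q \<Longrightarrow> v \<in> mat_range M \<Longrightarrow> v \<in> carrier_vec n"
  by (auto simp: mat_range_def)

text \<open>Stated for an arbitrary submodule because it is applied both to ranges of larger basis
  matrices and to a preimage under \<open>A\<close>.\<close>

lemma hess_L_mult_vec_in_submodule:
  assumes A: "A \<in> carrier_mat n n" and r: "r \<in> carrier_vec n"
    and N: "submodule class_ring N (module_vec TYPE(real) n)"
    and l: "\<And>q. q < j \<Longrightarrow> hess_l A r p q \<in> N" and c: "c \<in> carrier_vec j"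
  shows "hess_L A r p j *\<^sub>v c \<in> N"
  using l c
proof (induction j arbitrary: c)
  case 0
  then have "hess_L A r p 0 *\<^sub>v c = 0\<^sub>v n"
    using A by (intro eq_vecI) (auto simp: hess_L_def scalar_prod_def)
  then show ?case using submodule.zero_closed[OF N] by (simp add: module_vec_simps)
next
  case (Suc j)
  have "hess_L A r p j *\<^sub>v vec_first c j \<in> N" using Suc by auto
  moreover have "(c $ j) \<cdot>\<^sub>v hess_l A r p j \<in> N"
    using submodule.smult_closed[OF N, of "c $ j"] Suc.prems(1)[of j] by (simp add: module_vec_simps)
  ultimately show ?case
    unfolding hess_L_Suc_mult_vec[OF A r Suc.prems(2)]
    using submodule.m_closed[OF N] by (simp add: module_vec_simps)
qed

lemma hess_l_in_mat_range:
  assumes A: "A \<in> carrier_mat n n" and r: "r \<in> carrier_vec n" and "q < j"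
  shows "hess_l A r p q \<in> mat_range (hess_L A r p j)"
proof -
  have "hess_L A r p j *\<^sub>v unit_vec j q = hess_l A r p q"
  proof (rule eq_vecI)
    fix i assume "i < dim_vec (hess_l A r p q)"
    then have i: "i < n" using hess_carrier(2)[OF A r, of p q] by simp
    have "(hess_L A r p j *\<^sub>v unit_vec j q) $ i = (\<Sum>s<j. hess_l A r p s $ i * unit_vec j q $ s)"
      by (rule hess_L_mult_vec_index[OF A r _ i]) simp
    also have "\<dots> = (\<Sum>s<j. if s = q then hess_l A r p q $ i else 0)"
      using \<open>q < j\<close> by (intro sum.cong) auto
    also have "\<dots> = hess_l A r p q $ i" using \<open>q < j\<close> by simp
    finally show "(hess_L A r p j *\<^sub>v unit_vec j q) $ i = hess_l A r p q $ i" .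
  qed (use A hess_carrier(2)[OF A r, of p q] in \<open>auto simp: hess_L_def\<close>)
  then show ?thesis
    unfolding mat_range_def by (metis carrier_matD(2) hess_L_carrier imageI unit_vec_carrier)
qed

text \<open>Reads the sweep backwards: each step subtracts a multiple of a vector of
  \<open>N\<close>, so adding it back carries membership from the final vector to the initial
  one.\<close>

lemma fold_minus_smult_in_submodule:
  assumes N: "submodule class_ring N (module_vec TYPE(real) n)"
    and l: "\<And>j. j \<in> set js \<Longrightarrow> l j \<in> N" and u: "u \<in> carrier_vec n"
    and "fold (\<lambda>j u. u - f u j \<cdot>\<^sub>v l j) js u \<in> N"
  shows "u \<in> N"
  using l u assms(4)
proof (induction js arbitrary: u)
  case (Cons j js)
  have sub: "N \<subseteq> carrier_vec n"
    using submodule.subset[OF N] by (simp add: module_vec_simps)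
  have lj: "l j \<in> carrier_vec n" and ljN: "f u j \<cdot>\<^sub>v l j \<in> N"
    using Cons.prems(1)[of j] sub submodule.smult_closed[OF N, of "f u j" "l j"]
    by (auto simp: module_vec_simps)
  have "u - f u j \<cdot>\<^sub>v l j \<in> N"
    by (rule Cons.IH) (use Cons.prems lj in auto)
  then have "(u - f u j \<cdot>\<^sub>v l j) + f u j \<cdot>\<^sub>v l j \<in> N"
    using submodule.m_closed[OF N] ljN by (simp add: module_vec_simps)
  moreover have "(u - f u j \<cdot>\<^sub>v l j) + f u j \<cdot>\<^sub>v l j = u"
    using Cons.prems(2) lj by (intro eq_vecI) auto
  ultimately show ?case by simp
qed simp

lemma hess_w_eq_smult:
  assumes "hess_no_breakdown A r p k" and "m \<le> k"
  shows "hess_w A r p m = (hess_w A r p m $ p m) \<cdot>\<^sub>v hess_l A r p m"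
  using assms by (simp add: hess_l_def scale_at_def hess_no_breakdown_def smult_smult_assoc)

lemma hess_w_in_mat_range:
  assumes A: "A \<in> carrier_mat n n" and r: "r \<in> carrier_vec n"
    and nb: "hess_no_breakdown A r p k" and m: "m \<le> k" "m < j"
  shows "hess_w A r p m \<in> mat_range (hess_L A r p j)"
proof -
  have "hess_L A r p j \<in> carrier_mat n j" using A hess_L_carrier[of A r p j] by simp
  from submodule.smult_closed[OF mat_range_submodule[OF this] _ hess_l_in_mat_range[OF A r m(2)]]
  have "(hess_w A r p m $ p m) \<cdot>\<^sub>v hess_l A r p m \<in> mat_range (hess_L A r p j)"
    by (simp add: module_vec_simps)
  then show ?thesis by (simp only: hess_w_eq_smult[OF nb m(1), symmetric])
qed

text \<open>The range form of the relation between \<open>A\<close> times the basis and the next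
  larger basis, obtained without constructing the Hessenberg matrix of coefficients.\<close>

lemma mult_mat_vec_in_mat_range_hess_L:
  assumes A: "A \<in> carrier_mat n n" and r: "r \<in> carrier_vec n"
    and nb: "hess_no_breakdown A r p k" and j: "j \<le> k"
    and v: "v \<in> mat_range (hess_L A r p j)"
  shows "A *\<^sub>v v \<in> mat_range (hess_L A r p (Suc j))"
proof -
  let ?R = "mat_range (hess_L A r p (Suc j))"
  interpret vec_space "TYPE(real)" n .
  have LS: "hess_L A r p (Suc j) \<in> carrier_mat n (Suc j)"
    using A hess_L_carrier[of A r p "Suc j"] by simp
  note R = mat_range_submodule[OF LS]
  \<comment> \<open>The preimage of a submodule under a linear map is a submodule, so it suffices to
    place each column in \<open>S\<close>.\<close>
  define S where "S = {x \<in> carrier_vec n. A *\<^sub>v x \<in> ?R}"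
  have "A *\<^sub>v (0\<^sub>v n) = 0\<^sub>v n" using A by auto
  then have S: "submodule class_ring S (module_vec TYPE(real) n)"
    using submodule.m_closed[OF R] submodule.zero_closed[OF R] submodule.smult_closed[OF R] A
    by unfold_locales
      (auto simp: S_def module_vec_simps mult_add_distrib_mat_vec[OF A] mult_mat_vec[OF A])
  have "hess_l A r p q \<in> S" if q: "q < j" for q
  proof -
    have l: "hess_l A r p q \<in> carrier_vec n" by (rule hess_carrier(2)[OF A r])
    \<comment> \<open>Here \<open>q < j\<close> and \<open>j \<le> k\<close> give
      \<open>Suc q \<le> k\<close>, so the final vector of the sweep is a multiple of the basis
      vector of index \<open>Suc q\<close>.\<close>
    have "hess_w A r p (Suc q) \<in> ?R"
      using q j by (intro hess_w_in_mat_range[OF A r nb]) auto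
    then have "A *\<^sub>v hess_l A r p q \<in> ?R"
      unfolding hess_w_Suc
      by (rule fold_minus_smult_in_submodule[OF R, rotated 2])
        (use q A l in \<open>auto intro: hess_l_in_mat_range[OF A r]\<close>)
    then show ?thesis using l by (simp add: S_def)
  qed
  moreover obtain c where "c \<in> carrier_vec j" "v = hess_L A r p j *\<^sub>v c"
    using v hess_L_carrier[of A r p j] by (auto simp: mat_range_def)
  ultimately have "v \<in> S" using hess_L_mult_vec_in_submodule[OF A r S] by blast
  then show ?thesis by (simp add: S_def)
qed

lemma mat_range_hess_L_mono:
  assumes A: "A \<in> carrier_mat n n" and r: "r \<in> carrier_vec n" and "i \<le> j"
  shows "mat_range (hess_L A r p i) \<subseteq> mat_range (hess_L A r p j)"
proof
  fix v assume "v \<in> mat_range (hess_L A r p i)"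
  then obtain c where c: "c \<in> carrier_vec i" "v = hess_L A r p i *\<^sub>v c"
    using hess_L_carrier[of A r p i] by (auto simp: mat_range_def)
  have "hess_L A r p j \<in> carrier_mat n j" using A hess_L_carrier[of A r p j] by simp
  from hess_L_mult_vec_in_submodule[OF A r mat_range_submodule[OF this] _ c(1), where p = p]
  show "v \<in> mat_range (hess_L A r p j)"
    using hess_l_in_mat_range[OF A r] \<open>i \<le> j\<close> c(2) by simp
qed

text \<open>Every application of \<open>A\<close> costs one more basis column. The start
  \<open>j\<close> stays general because the induction applies the innermost factor first.\<close>

lemma pow_mat_mult_vec_in_mat_range_hess_L:
  assumes A: "A \<in> carrier_mat n n" and r: "r \<in> carrier_vec n"
    and nb: "hess_no_breakdown A r p k" and "j + i \<le> Suc k"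
    and "v \<in> mat_range (hess_L A r p j)"
  shows "(A ^\<^sub>m i) *\<^sub>v v \<in> mat_range (hess_L A r p (j + i))"
  using assms(4,5)
proof (induction i arbitrary: j v)
  case 0
  have "v \<in> carrier_vec n"
    using 0 A mat_range_carrier[OF hess_L_carrier] by auto
  then show ?case using 0 A by simp
next
  case (Suc i)
  have v: "v \<in> carrier_vec n"
    using Suc.prems A mat_range_carrier[OF hess_L_carrier] by auto
  have "(A ^\<^sub>m Suc i) *\<^sub>v v = (A ^\<^sub>m i) *\<^sub>v (A *\<^sub>v v)"
    using A v assoc_mult_mat_vec[of "A ^\<^sub>m i" n n A n v] by simp
  moreover have "A *\<^sub>v v \<in> mat_range (hess_L A r p (Suc j))"
    using Suc.prems by (intro mult_mat_vec_in_mat_range_hess_L[OF A r nb]) auto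
  ultimately show ?case using Suc.IH[of "Suc j" "A *\<^sub>v v"] Suc.prems by simp
qed

text \<open>\<open>r\<close> is a multiple of the first basis vector, so its image under the power
  \<open>i\<close> of \<open>A\<close> lies in the range of the first \<open>1 + i\<close> columns;
  the span is the least submodule containing these images.\<close>

lemma krylov_subset_mat_range:
  assumes A: "A \<in> carrier_mat n n" and r: "r \<in> carrier_vec n"
    and nb: "hess_no_breakdown A r p k" and j: "j \<le> Suc k"
  shows "krylov A r j \<subseteq> mat_range (hess_L A r p j)"
proof -
  interpret vec_space "TYPE(real)" n .
  have L: "hess_L A r p j \<in> carrier_mat n j" using A hess_L_carrier[of A r p j] by simp
  have "(A ^\<^sub>m i) *\<^sub>v r \<in> mat_range (hess_L A r p j)" if i: "i < j" for i
  proof -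
    have "r \<in> mat_range (hess_L A r p 1)"
      using hess_w_in_mat_range[OF A r nb, of 0 1] by simp
    then have "(A ^\<^sub>m i) *\<^sub>v r \<in> mat_range (hess_L A r p (1 + i))"
      using i j by (intro pow_mat_mult_vec_in_mat_range_hess_L[OF A r nb]) auto
    then show ?thesis using mat_range_hess_L_mono[OF A r, of "1 + i" j p] i by auto
  qed
  moreover have "dim_row A = n" using A by simp
  ultimately show ?thesis
    unfolding krylov_def using mat_range_submodule[OF L]
    by (simp only:) (intro span_is_subset; auto)
qed

section \<open>Hybrid residuals\<close>

text \<open>The two blocks match the block rows of \<open>hess_Lbar\<close>, so the block diagonal
  pseudoinverse acts on each of them separately.\<close>

lemma hr_eq_append:
  assumes A: "A \<in> carrier_mat n n" and b: "b \<in> carrier_vec n" and x: "x \<in> carrier_vec n"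
  shows "hr A b lam x = (b - A *\<^sub>v x) @\<^sub>v ((- lam) \<cdot>\<^sub>v x)"
proof -
  have "(lam \<cdot>\<^sub>m 1\<^sub>m n) *\<^sub>v x = lam \<cdot>\<^sub>v x"
    using x by (intro eq_vecI) auto
  then have "(A @\<^sub>r (lam \<cdot>\<^sub>m 1\<^sub>m n)) *\<^sub>v x = (A *\<^sub>v x) @\<^sub>v (lam \<cdot>\<^sub>v x)"
    using x by (subst mat_mult_append[OF A, of _ n]) auto
  then show ?thesis
    unfolding hr_def using A b x by (intro eq_vecI) auto
qed

lemma vnorm_hr_power2:
  assumes "A \<in> carrier_mat n n" and "b \<in> carrier_vec n" and "x \<in> carrier_vec n"
  shows "(vnorm (hr A b lam x))\<^sup>2 = (vnorm (b - A *\<^sub>v x))\<^sup>2 + lam\<^sup>2 * (vnorm x)\<^sup>2"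
  by (simp add: hr_eq_append[OF assms] vnorm_append_power2 vnorm_smult power_mult_distrib)

theorem theorem4p1:
  fixes n k :: nat and A :: "real mat" and b x0 r0 xG xC :: "real vec" and lam :: real
    and pivoting :: bool and p :: "nat \<Rightarrow> nat"
  assumes "A \<in> carrier_mat n n" and "b \<in> carrier_vec n" and "x0 \<in> carrier_vec n"
    and "r0 = b - A *\<^sub>v x0" and "r0 \<noteq> 0\<^sub>v n"
    and "1 \<le> k" and "k < n"
    and "hess_indices pivoting A r0 p k"
    and "hess_no_breakdown A r0 p k"
    and "hybrid_gmres_iterate A b lam r0 k xG"
    and "hybrid_cmrh_iterate A b lam r0 p k xC"
  shows "vnorm (hr A b lam xG) \<le> vnorm (hr A b lam xC) \<and>
         vnorm (hr A b lam xC) \<le> cond_number (hess_Lbar A r0 p k) * vnorm (hr A b lam xG)"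
proof
  note A = assms(1) and b = assms(2) and nb = assms(9)
  have r: "r0 \<in> carrier_vec n" using assms(1-4) by simp
  have p: "p ` {..k} \<subseteq> {..<n}" using assms(8) A by (auto simp: hess_indices_def)
  define L L' where "L = hess_L A r0 p (Suc k)" and "L' = hess_L A r0 p k"
  define X X' where "X = pinv L" and "X' = pinv L'"
  have L: "L \<in> carrier_mat n (Suc k)" and L': "L' \<in> carrier_mat n k"
    using A hess_L_carrier[of A r0 p] by (auto simp: L_def L'_def)
  have pX: "is_pinv L X" and pX': "is_pinv L' X'"
    unfolding L_def L'_def X_def X'_def using is_pinv_hess_L[OF A r nb p] by auto
  note X = is_pinvD(1)[OF pX L] and X' = is_pinvD(1)[OF pX' L']
  have xGK: "xG \<in> krylov A r0 k" and xCK: "xC \<in> krylov A r0 k"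
    using assms(10,11)
    by (auto simp: hybrid_gmres_iterate_def hybrid_cmrh_iterate_def is_arg_min_def)
  then have xGr: "xG \<in> mat_range L'" and xCr: "xC \<in> mat_range L'"
    using krylov_subset_mat_range[OF A r nb, of k] by (auto simp: L'_def)
  then have xG: "xG \<in> carrier_vec n" and xC: "xC \<in> carrier_vec n"
    using mat_range_carrier[OF L'] by auto
  \<comment> \<open>The left inequality: \<open>xC\<close> is a competitor in the GMRES
    minimisation.\<close>
  have "(vnorm (b - A *\<^sub>v xG))\<^sup>2 + lam\<^sup>2 * (vnorm xG)\<^sup>2
      \<le> (vnorm (b - A *\<^sub>v xC))\<^sup>2 + lam\<^sup>2 * (vnorm xC)\<^sup>2"
    using assms(10)[unfolded hybrid_gmres_iterate_def is_arg_min_linorder] xCK by simp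
  then show "vnorm (hr A b lam xG) \<le> vnorm (hr A b lam xC)"
    using vnorm_hr_power2[OF A b xG] vnorm_hr_power2[OF A b xC]
    by - (rule power2_le_imp_le; simp)

  define M Y where "M = four_block_mat L (0\<^sub>m n k) (0\<^sub>m n (Suc k)) L'"
    and "Y = four_block_mat X (0\<^sub>m (Suc k) n) (0\<^sub>m k n) X'"
  have Lbar: "hess_Lbar A r0 p k = M"
    using A by (simp add: hess_Lbar_def M_def L_def L'_def)
  have M: "M \<in> carrier_mat (n + n) (Suc k + k)" unfolding M_def by (rule four_block_carrier_mat[OF L L'])
  have pY: "is_pinv M Y"
    unfolding M_def Y_def by (rule is_pinv_block_diag[OF L L' pX pX'])
  have Mv: "M *\<^sub>v (c @\<^sub>v d) = (L *\<^sub>v c) @\<^sub>v (L' *\<^sub>v d)"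
    if "c \<in> carrier_vec (Suc k)" "d \<in> carrier_vec k" for c d
    unfolding M_def using L L' that
    by (subst four_block_mat_mult_vec[of _ n "Suc k" _ k _ n]) auto
  \<comment> \<open>The right-hand side is the CMRH objective; the sign of \<open>- lam\<close>
    disappears on squaring.\<close>
  have Yhr: "(vnorm (Y *\<^sub>v hr A b lam x))\<^sup>2
      = (vnorm (X *\<^sub>v (b - A *\<^sub>v x)))\<^sup>2 + lam\<^sup>2 * (vnorm (X' *\<^sub>v x))\<^sup>2"
    if x: "x \<in> carrier_vec n" for x
  proof -
    have "Y *\<^sub>v hr A b lam x = (X *\<^sub>v (b - A *\<^sub>v x)) @\<^sub>v ((- lam) \<cdot>\<^sub>v (X' *\<^sub>v x))"
      unfolding Y_def hr_eq_append[OF A b x] using A b x X X'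
      by (subst four_block_mat_mult_vec[of _ "Suc k" n _ n _ k])
        (auto simp: mult_mat_vec[OF X'])
    then show ?thesis
      by (simp add: vnorm_append_power2 vnorm_smult power_mult_distrib)
  qed
  \<comment> \<open>Now the roles are exchanged: \<open>xG\<close> is a competitor in the CMRH
    minimisation.\<close>
  have "(vnorm (X *\<^sub>v (b - A *\<^sub>v xC)))\<^sup>2 + lam\<^sup>2 * (vnorm (X' *\<^sub>v xC))\<^sup>2
      \<le> (vnorm (X *\<^sub>v (b - A *\<^sub>v xG)))\<^sup>2 + lam\<^sup>2 * (vnorm (X' *\<^sub>v xG))\<^sup>2"
    using assms(11)[unfolded hybrid_cmrh_iterate_def is_arg_min_linorder] xGK
    by (simp add: X_def X'_def L_def L'_def)
  then have le: "vnorm (Y *\<^sub>v hr A b lam xC) \<le> vnorm (Y *\<^sub>v hr A b lam xG)"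
    using Yhr[OF xG] Yhr[OF xC] by - (rule power2_le_imp_le; simp)

  obtain a c where a: "a \<in> carrier_vec k" "xG = L' *\<^sub>v a" and c: "c \<in> carrier_vec k" "xC = L' *\<^sub>v c"
    using xGr xCr L' by (auto simp: mat_range_def)
  define d where "d = a - c"
  have d: "d \<in> carrier_vec k" using a c by (simp add: d_def)
  have L'd: "L' *\<^sub>v d = xG - xC"
    unfolding d_def a(2) c(2) by (rule mult_minus_distrib_mat_vec[OF L' a(1) c(1)])
  \<comment> \<open>\<open>A\<close> sends the difference of the iterates into the range of
    \<open>L\<close>, which has one more column. The resulting \<open>e\<close> and
    \<open>lam \<cdot>\<^sub>v d\<close> are the two coefficient blocks of the difference of the
    residuals.\<close>
  have "L' *\<^sub>v d \<in> mat_range L'" using L' d by (auto simp: mat_range_def)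
  then have "A *\<^sub>v (L' *\<^sub>v d) \<in> mat_range L"
    unfolding L_def L'_def by (intro mult_mat_vec_in_mat_range_hess_L[OF A r nb]) auto
  then obtain e where e: "e \<in> carrier_vec (Suc k)" "A *\<^sub>v (xG - xC) = L *\<^sub>v e"
    using L L'd by (auto simp: mat_range_def)
  have diff: "hr A b lam xC = hr A b lam xG + M *\<^sub>v (e @\<^sub>v (lam \<cdot>\<^sub>v d))"
  proof -
    have "M *\<^sub>v (e @\<^sub>v (lam \<cdot>\<^sub>v d)) = (A *\<^sub>v (xG - xC)) @\<^sub>v (lam \<cdot>\<^sub>v (xG - xC))"
      using Mv e d L'd by (simp add: mult_mat_vec[OF L'])
    also have "\<dots> = (A *\<^sub>v xG - A *\<^sub>v xC) @\<^sub>v (lam \<cdot>\<^sub>v (xG - xC))"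
      by (simp add: mult_minus_distrib_mat_vec[OF A xG xC])
    finally show ?thesis
      unfolding hr_eq_append[OF A b xG] hr_eq_append[OF A b xC] using A b xG xC
      by (intro eq_vecI) (auto simp: algebra_simps)
  qed
  have cond: "1 \<le> cond_number M"
  proof -
    \<comment> \<open>The nonzero \<open>r0\<close>, padded with a zero block, is the nonzero vector
      in the range of \<open>M\<close> that \<open>cond_number_ge_1\<close> asks for.\<close>
    have "r0 \<in> mat_range L"
      unfolding L_def using hess_w_in_mat_range[OF A r nb, of 0 "Suc k"] by simp
    then obtain s where s: "s \<in> carrier_vec (Suc k)" "r0 = L *\<^sub>v s"
      using L by (auto simp: mat_range_def)
    have "(0\<^sub>v (n + n) :: real vec) = 0\<^sub>v n @\<^sub>v 0\<^sub>v n" by auto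
    then have "M *\<^sub>v (s @\<^sub>v 0\<^sub>v k) \<noteq> 0\<^sub>v (n + n)"
      using Mv[OF s(1), of "0\<^sub>v k"] s(2) assms(5) r by (simp add: append_vec_eq[of _ n])
    moreover have "s @\<^sub>v 0\<^sub>v k \<in> carrier_vec (Suc k + k)"
      using s(1) by (rule append_carrier_vec) simp
    ultimately show ?thesis using cond_number_ge_1[OF M pY] by blast
  qed
  have hr: "hr A b lam x \<in> carrier_vec (n + n)" if "x \<in> carrier_vec n" for x
    using that A b by (simp add: hr_eq_append)
  have "e @\<^sub>v (lam \<cdot>\<^sub>v d) \<in> carrier_vec (Suc k + k)"
    using e(1) by (rule append_carrier_vec) (use d in simp)
  from vnorm_le_cond_number_mult[OF M pY hr[OF xC] hr[OF xG] this diff le cond]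
  show "vnorm (hr A b lam xC) \<le> cond_number (hess_Lbar A r0 p k) * vnorm (hr A b lam xG)"
    unfolding Lbar .
qed

end
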